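(* Let $q$ be a prime power, let $n\ge 2$, and let $\mathcal{K}$ be a $q$-arc contained in a normal rational curve of $H_\infty=\mathrm{PG}(n,q)$. Then $\Lambda_{n,q}\cong \Gamma_{n,q}(\mathcal{K})$ as graphs.
   Context: A $k$-arc in $\mathrm{PG}(n,q)$ is a set of $k\ge n+1$ points such that no $n+1$ of them lie in a hyperplane (so a $q$-arc requires $q\ge n+1$). A normal rational curve in $\mathrm{PG}(n,q)$, $2\le n\le q$, is a set of $q+1$ points projectively equivalent to $\{(0,\ldots,0,1)\}\cup\{(1,t,t^2,\ldots,t^n)\mid t\in\mathbb{F}_q\}$. Embed $H_\infty=\mathrm{PG}(n,q)$ as a hyperplane in $\mathrm{PG}(n+1,q)$; points of $\mathrm{PG}(n+1,q)\setminus H_\infty$ are called affine. $\Gamma_{n,q}(\mathcal{K})$ is the bipartite graph whose vertex classes are the set of affine points and the set of lines of $\mathrm{PG}(n+1,q)$ not contained in $H_\infty$ and passing through a point of $\mathcal{K}$; adjacency is incidence. The Lazebnik–Viglione graph $\Lambda_{n,q}$ is the bipartite graph whose vertex classes are two disjoint copies $\mathcal{P}_n$ and $\mathcal{L}_n$ of $\mathbb{F}_q^{n+1}$, where $(p_1,\ldots,p_{n+1})\in\mathcal{P}_n$ is adjacent to $[l_1,\ldots,l_{n+1}]\in\mathcal{L}_n$ if and only if $l_{i+1}+p_{i+1}=p_1l_i$ for all $1\le i\le n$. *)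

theory Defs
  imports Complex_Main "HOL-Library.Function_Algebras" "HOL-Library.Cardinality"
begin

section \<open>Coordinate vector spaces\<close>

text \<open>Vectors are functions on the natural numbers. The space \<open>F\<^sup>m\<close> consists of those that vanish
  from index \<open>m\<close> on, so coordinates are numbered \<open>0, \<dots>, m - 1\<close>.\<close>

type_synonym 'a fvec = "nat \<Rightarrow> 'a"

definition fscale :: "'a::field \<Rightarrow> 'a fvec \<Rightarrow> 'a fvec" where
  "fscale c v = (\<lambda>i. c * v i)"

global_interpretation fv: vector_space fscale
  by unfold_locales (auto simp: fscale_def fun_eq_iff algebra_simps)

definition coord_space :: "nat \<Rightarrow> 'a::field fvec set" where
  "coord_space m = {v. \<forall>i\<ge>m. v i = 0}"


section \<open>Projective geometry\<close>

text \<open>A projective space is given by its underlying vector space \<open>W\<close>, with \<open>dim W = n + 1\<close> for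
  projective dimension \<open>n\<close>; in particular \<open>PG(n,q)\<close> is given by \<open>coord_space (n + 1)\<close>.
  A projective subspace is identified with the linear subspace of \<open>W\<close> that it comes from,
  so incidence is inclusion.\<close>

definition pg_points :: "'a::field fvec set \<Rightarrow> 'a fvec set set" where
  "pg_points W = {U. fv.subspace U \<and> U \<subseteq> W \<and> fv.dim U = 1}"

definition pg_lines :: "'a::field fvec set \<Rightarrow> 'a fvec set set" where
  "pg_lines W = {U. fv.subspace U \<and> U \<subseteq> W \<and> fv.dim U = 2}"

definition pg_hyperplanes :: "'a::field fvec set \<Rightarrow> 'a fvec set set" where
  "pg_hyperplanes W = {U. fv.subspace U \<and> U \<subseteq> W \<and> fv.dim U + 1 = fv.dim W}"

definition pg_arc :: "nat \<Rightarrow> 'a::field fvec set \<Rightarrow> nat \<Rightarrow> 'a fvec set set \<Rightarrow> bool" where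
  "pg_arc n W k K \<longleftrightarrow>
     K \<subseteq> pg_points W \<and> finite K \<and> card K = k \<and> k \<ge> n + 1 \<and>
     (\<forall>S\<subseteq>K. card S = n + 1 \<longrightarrow> \<not> (\<exists>h\<in>pg_hyperplanes W. \<forall>P\<in>S. P \<subseteq> h))"

text \<open>Projective equivalence is taken with respect to projectivities, that is, maps induced by
  linear isomorphisms. Allowing semilinear ones would yield the same normal rational
  curves, because field automorphisms preserve the standard one. Only the restriction of \<open>f\<close>
  to \<open>W\<close> matters; it is an isomorphism onto \<open>W'\<close>.\<close>

definition projectively_equivalent ::
  "'a::field fvec set \<Rightarrow> 'a fvec set set \<Rightarrow> 'a fvec set \<Rightarrow> 'a fvec set set \<Rightarrow> bool" where
  "projectively_equivalent W A W' B \<longleftrightarrow>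
     (\<exists>f. Vector_Spaces.linear fscale fscale f \<and> bij_betw f W W' \<and> B = (\<lambda>P. f ` P) ` A)"

definition moment_vector :: "nat \<Rightarrow> 'a::field \<Rightarrow> 'a fvec" where
  "moment_vector n t = (\<lambda>i. if i \<le> n then t ^ i else 0)"

definition last_unit_vector :: "nat \<Rightarrow> 'a::field fvec" where
  "last_unit_vector n = (\<lambda>i. if i = n then 1 else 0)"

definition standard_nrc :: "nat \<Rightarrow> 'a::field fvec set set" where
  "standard_nrc n =
     insert (fv.span {last_unit_vector n}) (range (\<lambda>t. fv.span {moment_vector n t}))"

definition normal_rational_curve ::
  "nat \<Rightarrow> 'a::{field,finite} fvec set \<Rightarrow> 'a fvec set set \<Rightarrow> bool" where
  "normal_rational_curve n W N \<longleftrightarrow>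
     2 \<le> n \<and> n \<le> CARD('a) \<and>
     projectively_equivalent (coord_space (n + 1)) (standard_nrc n) W N"


section \<open>Graphs\<close>

text \<open>A simple graph is a pair of a vertex set and a set of two-element edges.\<close>

type_synonym 'v graph = "'v set \<times> 'v set set"

definition graph_isomorphic :: "'v graph \<Rightarrow> 'w graph \<Rightarrow> bool" where
  "graph_isomorphic G G' \<longleftrightarrow>
     (\<exists>f. bij_betw f (fst G) (fst G') \<and>
          (\<forall>u\<in>fst G. \<forall>v\<in>fst G. {u, v} \<in> snd G \<longleftrightarrow> {f u, f v} \<in> snd G'))"

definition bipartite_graph :: "'u set \<Rightarrow> 'v set \<Rightarrow> ('u \<Rightarrow> 'v \<Rightarrow> bool) \<Rightarrow> ('u + 'v) graph" where
  "bipartite_graph A B adj = (A <+> B, {{Inl a, Inr b} | a b. a \<in> A \<and> b \<in> B \<and> adj a b})"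

text \<open>In \<open>Gamma_graph n H K\<close> the ambient space is \<open>PG(n+1,q)\<close>, and \<open>H\<close> is the
  hyperplane at infinity.\<close>

definition affine_points :: "nat \<Rightarrow> 'a::field fvec set \<Rightarrow> 'a fvec set set" where
  "affine_points n H = {P \<in> pg_points (coord_space (n + 2)). \<not> P \<subseteq> H}"

definition affine_lines_through ::
  "nat \<Rightarrow> 'a::field fvec set \<Rightarrow> 'a fvec set set \<Rightarrow> 'a fvec set set" where
  "affine_lines_through n H K =
     {L \<in> pg_lines (coord_space (n + 2)). \<not> L \<subseteq> H \<and> (\<exists>P\<in>K. P \<subseteq> L)}"

definition Gamma_graph ::
  "nat \<Rightarrow> 'a::field fvec set \<Rightarrow> 'a fvec set set \<Rightarrow> ('a fvec set + 'a fvec set) graph" where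
  "Gamma_graph n H K =
     bipartite_graph (affine_points n H) (affine_lines_through n H K) (\<subseteq>)"

text \<open>Since coordinates start at 0, the entries \<open>p i\<close> and \<open>l i\<close> are those traditionally written
  \<open>p\<^sub>i\<^sub>+\<^sub>1\<close> and \<open>l\<^sub>i\<^sub>+\<^sub>1\<close>.\<close>

definition Lambda_graph :: "nat \<Rightarrow> ('a::field fvec + 'a fvec) graph" where
  "Lambda_graph n =
     bipartite_graph (coord_space (n + 1)) (coord_space (n + 1))
       (\<lambda>p l. \<forall>i<n. l (i + 1) + p (i + 1) = p 0 * l i)"

end

theory Submission
  imports Defs
begin

text \<open>Up to a projectivity of the normal rational curve, the missing point of \<open>K\<close> is the last unit
  vector, so \<open>K\<close> consists of the points \<open>(1, t, \<dots>, t\<^sup>n)\<close> in suitable coordinates of \<open>H\<close>. An affine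
  point is given by a coordinate vector \<open>l\<close>, and the line of direction \<open>(1, t, \<dots>, t\<^sup>n)\<close> through
  \<open>y\<close> consists of the vectors \<open>l = y + c (1, t, \<dots>, t\<^sup>n)\<close>. These are exactly the solutions of the
  recurrence \<open>l\<^sub>i\<^sub>+\<^sub>1 = t l\<^sub>i - p\<^sub>i\<^sub>+\<^sub>1\<close> for suitable \<open>p\<close> with \<open>p\<^sub>0 = t\<close>. Hence points of \<open>\<Lambda>\<close>
  correspond to lines of \<open>\<Gamma>\<close>, and lines of \<open>\<Lambda>\<close> to affine points.\<close>

section \<open>Spans and dimensions\<close>

lemma fscale_apply [simp]: "fscale c v i = c * v i"
  by (simp add: fscale_def)

lemma subspace_coord_space: "fv.subspace (coord_space m)"
  by (auto simp: fv.subspace_def coord_space_def)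

lemma finite_coord_space: "finite (coord_space m :: 'a::{field,finite} fvec set)"
proof -
  have "coord_space m = {f :: 'a fvec. \<forall>i. (i \<in> {..<m} \<longrightarrow> f i \<in> UNIV) \<and> (i \<notin> {..<m} \<longrightarrow> f i = 0)}"
    by (auto simp: coord_space_def)
  then show ?thesis
    using finite_set_of_finite_funs[of "{..<m}" "UNIV :: 'a set" 0] by simp
qed

lemma moment_vector_in_coord_space: "moment_vector n t \<in> coord_space (n + 1)"
  by (simp add: moment_vector_def coord_space_def)

text \<open>An infinite basis has \<open>card\<close> 0, so the positive dimension makes the basis
  \<open>B\<close> of \<open>U\<close> finite. A vector of \<open>U\<close> outside
  \<open>fv.span C\<close> would then give an independent set larger than \<open>B\<close>, against
  the exchange bound.\<close>

lemma span_eq_if_dim_eq_card: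
  assumes "fv.independent C" "C \<subseteq> U" "fv.subspace U" "fv.dim U = card C" "0 < card C"
  shows "fv.span C = U"
proof (rule ccontr)
  assume "fv.span C \<noteq> U"
  moreover have "fv.span C \<subseteq> U"
    using assms(2,3) by (rule fv.span_minimal)
  ultimately obtain x where x: "x \<in> U" "x \<notin> fv.span C"
    by blast
  obtain B where B: "fv.independent B" "U \<subseteq> fv.span B" "card B = fv.dim U"
    by (rule fv.basis_exists[of U])
  have "finite B"
    using B assms(4,5) by (intro card_ge_0_finite) simp
  moreover have "insert x C \<subseteq> fv.span B"
    using B(2) assms(2) x(1) by blast
  ultimately have "card (insert x C) \<le> card B"
    using fv.independent_span_bound[of B] fv.independent_insertI[OF x(2) assms(1)] by blast
  moreover have "x \<notin> C"
    using x fv.span_base by blast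
  moreover have "finite C"
    using assms card_ge_0_finite by blast
  ultimately show False
    using B assms by simp
qed

lemma mem_span_singleton: "x \<in> fv.span {a} \<longleftrightarrow> (\<exists>c. x = fscale c a)"
  by (auto simp: fv.span_singleton)

lemma mem_span_pair: "x \<in> fv.span {a, b} \<longleftrightarrow> (\<exists>c d. x = fscale c a + fscale d b)"
  by (auto simp: fv.span_breakdown_eq[of x a] mem_span_singleton algebra_simps)

lemma span_singleton_subset_iff: "fv.subspace U \<Longrightarrow> fv.span {x} \<subseteq> U \<longleftrightarrow> x \<in> U"
  using fv.span_base fv.span_minimal by blast

lemma span_scale_singleton: "c \<noteq> 0 \<Longrightarrow> fv.span {fscale c x} = fv.span {x}"
  by (rule fv.span_image_scale[of "{x}" "\<lambda>_. c", simplified])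

lemma mem_pg_points_iff:
  assumes "fv.subspace W"
  shows "P \<in> pg_points W \<longleftrightarrow> (\<exists>x\<in>W. x \<noteq> 0 \<and> P = fv.span {x})"
proof
  assume P: "P \<in> pg_points W"
  obtain B where B: "B \<subseteq> P" "fv.independent B" "P \<subseteq> fv.span B" "card B = fv.dim P"
    by (rule fv.basis_exists[of P])
  then obtain x where "B = {x}"
    using P by (auto simp: pg_points_def card_1_singleton_iff)
  then show "\<exists>x\<in>W. x \<noteq> 0 \<and> P = fv.span {x}"
    using B P span_singleton_subset_iff[of P x] by (auto simp: pg_points_def)
next
  assume "\<exists>x\<in>W. x \<noteq> 0 \<and> P = fv.span {x}"
  then obtain x where x: "x \<in> W" "x \<noteq> 0" "P = fv.span {x}" by blast
  then have "fv.dim P = 1"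
    by (simp add: fv.dim_eq_card_independent)
  then show "P \<in> pg_points W"
    using x assms by (auto simp: pg_points_def span_singleton_subset_iff)
qed

lemma mem_affine_points_iff:
  assumes "fv.subspace H"
  shows "P \<in> affine_points n H \<longleftrightarrow> (\<exists>x\<in>coord_space (n + 2). x \<notin> H \<and> P = fv.span {x})"
  using span_singleton_subset_iff[OF assms] fv.subspace_0[OF assms]
  unfolding affine_points_def mem_Collect_eq mem_pg_points_iff[OF subspace_coord_space] by metis

lemma independent_pair:
  assumes "fv.subspace H" "x \<notin> H" "k \<in> H" "k \<noteq> 0"
  shows "fv.independent {x, k}" "card {x, k} = 2"
proof -
  have "x \<notin> fv.span {k}"
    using assms span_singleton_subset_iff by blast
  then show "fv.independent {x, k}"
    using assms by (simp add: fv.independent_insert)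
  show "card {x, k} = 2"
    using assms by (metis card_2_iff)
qed

text \<open>Any \<open>v\<close> in \<open>W\<close> outside \<open>H\<close> extends a basis of
  \<open>H\<close> to an independent set of size \<open>fv.dim W\<close>, hence to a basis of
  \<open>W\<close>. Finiteness comes from \<open>fv.dim W = fv.dim H + 1\<close>, which is
  positive.\<close>

lemma hyperplane_complement:
  assumes "H \<in> pg_hyperplanes W" "fv.subspace W"
  obtains v where "v \<in> W" "v \<notin> H" "\<And>x. x \<in> W \<Longrightarrow> \<exists>c. \<exists>h\<in>H. x = fscale c v + h"
proof -
  have H: "fv.subspace H" "H \<subseteq> W" "fv.dim H + 1 = fv.dim W"
    using assms by (auto simp: pg_hyperplanes_def)
  then obtain v where v: "v \<in> W" "v \<notin> H"
    by (metis add_cancel_left_right psubsetE psubsetI subsetI zero_neq_one)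
  obtain D where D: "fv.independent D" "W \<subseteq> fv.span D" "card D = fv.dim W"
    by (rule fv.basis_exists[of W])
  obtain B where B: "B \<subseteq> H" "fv.independent B" "H \<subseteq> fv.span B" "card B = fv.dim H"
    by (rule fv.basis_exists[of H])
  have "fv.span B = H"
    using B H by (simp add: fv.span_subspace)
  have "finite D"
    using D(3) H(3) by (intro card_ge_0_finite) simp
  then have "finite B"
    using fv.independent_span_bound[of D B] B D H by blast
  then have "card (insert v B) = fv.dim W"
    using B H v by (subst card_insert_disjoint) auto
  moreover have "fv.independent (insert v B)"
    using B v \<open>fv.span B = H\<close> by (simp add: fv.independent_insertI)
  ultimately have "fv.span (insert v B) = W"
    using B H v assms by (intro span_eq_if_dim_eq_card) auto
  then have "\<exists>c. \<exists>h\<in>H. x = fscale c v + h" if "x \<in> W" for x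
    using that fv.span_breakdown_eq[of x v B] \<open>fv.span B = H\<close>
    by (metis add.commute diff_add_cancel)
  with v show ?thesis using that by blast
qed


section \<open>Moving a point of the normal rational curve to infinity\<close>

text \<open>The map induced by \<open>s \<mapsto> a + 1 / s\<close>, with the moment vector of \<open>a + 1 / s\<close> multiplied
  by \<open>s\<^sup>n\<close>.\<close>

definition nrc_shift :: "nat \<Rightarrow> 'a::field \<Rightarrow> 'a fvec \<Rightarrow> 'a fvec" where
  "nrc_shift n a u =
     (\<lambda>i. if i \<le> n then \<Sum>k\<le>i. of_nat (i choose k) * a ^ (i - k) * u (n - k) else 0)"

lemma linear_nrc_shift: "Vector_Spaces.linear fscale fscale (nrc_shift n a)"
  by unfold_locales
    (auto simp: nrc_shift_def fun_eq_iff algebra_simps sum.distrib sum_distrib_left)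

text \<open>The binomial theorem for \<open>(1 + a * s) ^ i\<close>. The homogeneous form has no
  division, so it also covers \<open>s = 0\<close>, where \<open>a + 1 / s\<close> stands for the
  parameter at infinity.\<close>

lemma nrc_shift_moment_vector:
  "nrc_shift n a (moment_vector n s) = (\<lambda>i. if i \<le> n then s ^ (n - i) * (a * s + 1) ^ i else 0)"
proof
  fix i
  show "nrc_shift n a (moment_vector n s) i = (if i \<le> n then s ^ (n - i) * (a * s + 1) ^ i else 0)"
  proof (cases "i \<le> n")
    case True
    have "of_nat (i choose k) * a ^ (i - k) * s ^ (n - k) =
        s ^ (n - i) * (of_nat (i choose k) * 1 ^ k * (a * s) ^ (i - k))" if "k \<le> i" for k
    proof -
      have "n - k = (n - i) + (i - k)"
        using True that by simp
      then show ?thesis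
        by (simp only: power_add power_mult_distrib power_one mult_ac mult_1)
    qed
    then have "nrc_shift n a (moment_vector n s) i =
        (\<Sum>k\<le>i. s ^ (n - i) * (of_nat (i choose k) * 1 ^ k * (a * s) ^ (i - k)))"
      unfolding nrc_shift_def if_P[OF True] by (intro sum.cong) (simp_all add: moment_vector_def)
    also have "\<dots> = s ^ (n - i) * (1 + a * s) ^ i"
      by (simp only: binomial_ring sum_distrib_left)
    finally show ?thesis
      using True by (simp add: add.commute)
  qed (simp add: nrc_shift_def)
qed

lemma nrc_shift_moment_vector_0: "nrc_shift n a (moment_vector n 0) = last_unit_vector n"
  by (auto simp: nrc_shift_moment_vector last_unit_vector_def)

lemma nrc_shift_moment_vector_nonzero:
  assumes "s \<noteq> 0"
  shows "nrc_shift n a (moment_vector n s) = fscale (s ^ n) (moment_vector n (a + 1 / s))"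
proof
  fix i
  have "s ^ (n - i) * (a * s + 1) ^ i = s ^ n * (a + 1 / s) ^ i" if "i \<le> n"
  proof -
    have "a * s + 1 = s * (a + 1 / s)"
      using assms by (simp add: field_simps)
    then have "s ^ (n - i) * (a * s + 1) ^ i = (s ^ (n - i) * s ^ i) * (a + 1 / s) ^ i"
      by (simp add: power_mult_distrib)
    then show ?thesis
      using that by (simp flip: power_add)
  qed
  then show "nrc_shift n a (moment_vector n s) i = fscale (s ^ n) (moment_vector n (a + 1 / s)) i"
    by (simp add: nrc_shift_moment_vector) (simp add: moment_vector_def)
qed

text \<open>With the coordinates of the argument reversed, the matrix is lower triangular with ones
  on the diagonal, so the kernel is trivial. Injectivity suffices because the space is
  finite.\<close>

lemma bij_betw_nrc_shift:
  "bij_betw (nrc_shift n a) (coord_space (n + 1)) (coord_space (n + 1) :: 'a::{field,finite} fvec set)"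
proof -
  interpret L: Vector_Spaces.linear fscale fscale "nrc_shift n a" by (rule linear_nrc_shift)
  have zero: "u = 0" if u: "u \<in> coord_space (n + 1)" and eq: "nrc_shift n a u = 0" for u :: "'a fvec"
  proof -
    have 0: "i \<le> n \<longrightarrow> u (n - i) = 0" for i
    proof (induction i rule: less_induct)
      case (less i)
      show ?case
      proof
        assume i: "i \<le> n"
        \<comment> \<open>The entries \<open>u (n - k)\<close> with \<open>k < i\<close> vanish by
          induction; the term \<open>k = i\<close> has coefficient 1.\<close>
        have "nrc_shift n a u i = (\<Sum>k\<le>i. if k = i then u (n - i) else 0)"
          unfolding nrc_shift_def if_P[OF i] using i less by (intro sum.cong) auto
        then show "u (n - i) = 0"
          using eq by simp
      qed
    qed
    have "u j = 0" for j
    proof (cases "j \<le> n")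
      case True
      then show ?thesis
        using 0[of "n - j"] by simp
    next
      case False
      then show ?thesis
        using u by (simp add: coord_space_def)
    qed
    then show ?thesis
      by (simp add: fun_eq_iff)
  qed
  have "inj_on (nrc_shift n a) (coord_space (n + 1))"
  proof (rule inj_onI)
    fix x y :: "'a fvec"
    assume *: "x \<in> coord_space (n + 1)" "y \<in> coord_space (n + 1)" "nrc_shift n a x = nrc_shift n a y"
    have "x - y = 0"
    proof (rule zero)
      show "x - y \<in> coord_space (n + 1)"
        using *(1,2) by (rule fv.subspace_diff[OF subspace_coord_space])
      show "nrc_shift n a (x - y) = 0"
        using *(3) by (simp add: L.diff)
    qed
    then show "x = y" by simp
  qed
  moreover have "nrc_shift n a ` coord_space (n + 1) \<subseteq> (coord_space (n + 1) :: 'a fvec set)"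
    by (auto simp: nrc_shift_def coord_space_def)
  ultimately show ?thesis
    by (simp add: bij_betw_def endo_inj_surj finite_coord_space)
qed

lemma moment_vector_eq_scaleD:
  assumes "n \<ge> 1" "moment_vector n s = fscale c (moment_vector n t)"
  shows "c = 1 \<and> s = t"
  using fun_cong[OF assms(2), of 0] fun_cong[OF assms(2), of 1] assms(1)
  by (auto simp: moment_vector_def)

text \<open>A set of q points of the curve omits one of its q + 1 points. If that is the point at
  infinity, the identity serves as \<open>g\<close>. If it is the point with parameter
  \<open>a\<close>, then \<open>nrc_shift n a\<close> serves: \<open>a + 1 / s\<close> takes every
  finite value except \<open>a\<close> for nonzero \<open>s\<close>, and \<open>s = 0\<close> yields
  the point at infinity.\<close>

lemma standard_nrc_delete_point:
  fixes S :: "'a::{field,finite} fvec set set"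
  assumes "n \<ge> 1" "S \<subseteq> standard_nrc n" "card S = CARD('a)"
  obtains g where "Vector_Spaces.linear fscale fscale g"
    and "bij_betw g (coord_space (n + 1)) (coord_space (n + 1) :: 'a fvec set)"
    and "S = range (\<lambda>t. fv.span {g (moment_vector n t)})"
proof (cases "fv.span {last_unit_vector n} \<in> S")
  case False
  let ?m = "\<lambda>t::'a. fv.span {moment_vector n t}"
  have "S \<subseteq> range ?m"
    using assms False by (auto simp: standard_nrc_def)
  then have "S = range ?m"
    using assms(3) card_image_le[of UNIV ?m] by (intro card_seteq) auto
  then show ?thesis
    using that[of id] fv.linear_id by simp
next
  case True
  let ?m = "\<lambda>t::'a. fv.span {moment_vector n t}" and ?e = "fv.span {last_unit_vector n :: 'a fvec}"
  have "finite S"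
    using assms(3) by (intro card_ge_0_finite) simp
  have "inj ?m"
  proof (rule injI)
    fix s t assume "?m s = ?m t"
    then have "moment_vector n s \<in> ?m t"
      using fv.span_base[of "moment_vector n s"] by blast
    then show "s = t"
      using moment_vector_eq_scaleD[OF assms(1)] by (auto simp: mem_span_singleton)
  qed
  then have "card (range ?m) = CARD('a)"
    by (simp add: card_image)
  moreover have "card (S - {?e}) < CARD('a)"
    using True \<open>finite S\<close> assms(3) card_Diff1_less[of S ?e] by simp
  \<comment> \<open>\<open>S\<close> spends one of its q points on infinity, so it cannot contain
    all q finite points of the curve.\<close>
  ultimately have "\<not> range ?m \<subseteq> S - {?e}"
    using card_mono[of "S - {?e}" "range ?m"] \<open>finite S\<close> by auto
  then obtain a where a: "?m a \<notin> S - {?e}"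
    by blast
  let ?g = "nrc_shift n a"
  let ?P = "\<lambda>t. fv.span {?g (moment_vector n t)}"
  have "S \<subseteq> range ?P"
  proof
    fix P assume "P \<in> S"
    have e: "?e = ?P 0"
      by (simp add: nrc_shift_moment_vector_0)
    show "P \<in> range ?P"
    proof (cases "P = ?e")
      case False
      then obtain t where t: "P = ?m t"
        using \<open>P \<in> S\<close> assms(2) by (auto simp: standard_nrc_def)
      then have "t \<noteq> a"
        using a False \<open>P \<in> S\<close> by auto
      \<comment> \<open>The parameter \<open>1 / (t - a)\<close> is the solution \<open>s\<close> of
        \<open>a + 1 / s = t\<close>.\<close>
      then have "?P (1 / (t - a)) = fv.span {moment_vector n t}"
        by (simp add: nrc_shift_moment_vector_nonzero span_scale_singleton)
      with t show ?thesis
        by (metis rangeI)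
    qed (use e in blast)
  qed
  \<comment> \<open>\<open>range ?P\<close> has at most q points and contains \<open>S\<close>,
    which has exactly q.\<close>
  then have "S = range ?P"
    using assms(3) card_image_le[of UNIV ?P] by (intro card_seteq) auto
  then show ?thesis
    by (rule that[OF linear_nrc_shift bij_betw_nrc_shift])
qed


section \<open>Coordinates on the graphs\<close>

text \<open>The two classes are exchanged because the points of the first graph will be sent to the
  lines of the second. Edges are unordered pairs, so exchanging the summands of the vertex type is
  harmless.\<close>

lemma graph_isomorphic_bipartite_swap:
  assumes "bij_betw \<alpha> A B'" "bij_betw \<beta> B A'"
    and "\<And>a b. a \<in> A \<Longrightarrow> b \<in> B \<Longrightarrow> adj a b \<longleftrightarrow> adj' (\<beta> b) (\<alpha> a)"
  shows "graph_isomorphic (bipartite_graph A B adj) (bipartite_graph A' B' adj')"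
proof -
  let ?f = "case_sum (\<lambda>a. Inr (\<alpha> a)) (\<lambda>b. Inl (\<beta> b))"
  have "bij_betw ?f (A <+> B) (A' <+> B')"
  proof (rule bij_betw_imageI)
    show "inj_on ?f (A <+> B)"
      using bij_betw_imp_inj_on[OF assms(1)] bij_betw_imp_inj_on[OF assms(2)]
      by (intro inj_onI) (auto dest: inj_onD)
    show "?f ` (A <+> B) = A' <+> B'"
      unfolding bij_betw_imp_surj_on[OF assms(1), symmetric]
        bij_betw_imp_surj_on[OF assms(2), symmetric]
      by (simp add: Plus_def image_Un image_image Un_commute)
  qed
  moreover have "{u, v} \<in> snd (bipartite_graph A B adj) \<longleftrightarrow>
      {?f u, ?f v} \<in> snd (bipartite_graph A' B' adj')" if "u \<in> A <+> B" "v \<in> A <+> B" for u v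
    using that assms(3) bij_betwE[OF assms(1)] bij_betwE[OF assms(2)]
    by (auto simp: bipartite_graph_def doubleton_eq_iff)
  ultimately show ?thesis
    unfolding graph_isomorphic_def by (intro exI[of _ ?f]) (simp add: bipartite_graph_def)
qed

section \<open>Neighbourhoods in the Lazebnik-Viglione graph\<close>

definition Lambda_adj :: "nat \<Rightarrow> 'a::field fvec \<Rightarrow> 'a fvec \<Rightarrow> bool" where
  "Lambda_adj n p l \<longleftrightarrow> (\<forall>i<n. l (i + 1) + p (i + 1) = p 0 * l i)"

text \<open>The neighbour of \<open>p\<close> with entry \<open>c\<close> at index 0.\<close>

primrec Lambda_rec :: "'a::field fvec \<Rightarrow> 'a \<Rightarrow> 'a fvec" where
  "Lambda_rec p c 0 = c"
| "Lambda_rec p c (Suc i) = p 0 * Lambda_rec p c i - p (Suc i)"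

definition Lambda_nbr :: "nat \<Rightarrow> 'a::field fvec \<Rightarrow> 'a \<Rightarrow> 'a fvec" where
  "Lambda_nbr n p c = (\<lambda>i. if i \<le> n then Lambda_rec p c i else 0)"

lemma Lambda_nbr_in_coord_space: "Lambda_nbr n p c \<in> coord_space (n + 1)"
  by (simp add: Lambda_nbr_def coord_space_def)

text \<open>For fixed \<open>p\<close> the edge equations form a first-order recurrence for
  \<open>l\<close>, so \<open>p\<close> has exactly one neighbour for each choice of the entry at
  index 0.\<close>

lemma Lambda_adj_iff:
  assumes "l \<in> coord_space (n + 1)"
  shows "Lambda_adj n p l \<longleftrightarrow> l = Lambda_nbr n p (l 0)"
proof
  assume adj: "Lambda_adj n p l"
  have rec: "i \<le> n \<longrightarrow> l i = Lambda_rec p (l 0) i" for i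
  proof (induction i)
    case (Suc i)
    then show ?case
      using adj by (auto simp: Lambda_adj_def Suc_le_eq eq_diff_eq)
  qed simp
  have "l i = Lambda_nbr n p (l 0) i" for i
  proof (cases "i \<le> n")
    case True
    then show ?thesis
      unfolding Lambda_nbr_def if_P[OF True] using rec[of i] by blast
  next
    case False
    then show ?thesis
      using assms by (simp add: Lambda_nbr_def coord_space_def)
  qed
  then show "l = Lambda_nbr n p (l 0)"
    by blast
next
  assume l: "l = Lambda_nbr n p (l 0)"
  show "Lambda_adj n p l"
    unfolding Lambda_adj_def
  proof (intro allI impI)
    fix i assume "i < n"
    then have "l (i + 1) = Lambda_rec p (l 0) (i + 1)" "l i = Lambda_rec p (l 0) i"
      using fun_cong[OF l, of "i + 1"] fun_cong[OF l, of i] by (simp_all add: Lambda_nbr_def)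
    then show "l (i + 1) + p (i + 1) = p 0 * l i"
      by simp
  qed
qed

lemma Lambda_nbr_0 [simp]: "Lambda_nbr n p c 0 = c"
  by (simp add: Lambda_nbr_def)

lemma Lambda_adj_nbr_iff: "Lambda_adj n p (Lambda_nbr n r c) \<longleftrightarrow> Lambda_nbr n r c = Lambda_nbr n p c"
  unfolding Lambda_adj_iff[OF Lambda_nbr_in_coord_space] Lambda_nbr_0 ..

text \<open>The recurrence is affine, and the solutions of its homogeneous part are the multiples of
  the powers of \<open>p 0\<close>. Hence the neighbourhood of \<open>p\<close> is an affine line
  whose direction is a moment vector.\<close>

lemma Lambda_nbr_eq_add:
  "Lambda_nbr n p c = Lambda_nbr n p 0 + fscale c (moment_vector n (p 0))"
proof
  fix i
  have "Lambda_rec p c i = Lambda_rec p 0 i + c * p 0 ^ i"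
    by (induction i) (simp_all add: algebra_simps)
  then show "Lambda_nbr n p c i = (Lambda_nbr n p 0 + fscale c (moment_vector n (p 0))) i"
    by (simp add: Lambda_nbr_def moment_vector_def)
qed

text \<open>A point can be recovered from its neighbourhood; this will give injectivity of the map
  from points to lines of the geometry.\<close>

lemma Lambda_points_eqI:
  assumes n: "n \<ge> 1" and p: "p \<in> coord_space (n + 1)" "p' \<in> coord_space (n + 1)"
    and eq: "\<And>l. l \<in> coord_space (n + 1) \<Longrightarrow> Lambda_adj n p l \<longleftrightarrow> Lambda_adj n p' l"
  shows "p = p'"
proof -
  have nbr: "Lambda_nbr n p c = Lambda_nbr n p' c" for c
    using eq[OF Lambda_nbr_in_coord_space, of p c] unfolding Lambda_adj_nbr_iff by blast
  \<comment> \<open>The neighbours starting with 0 and 1 have entries \<open>- p 1\<close> and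
    \<open>p 0 - p 1\<close> at index 1, and these differ by \<open>p 0\<close>. The index 1 is
    available because \<open>n\<close> is positive.\<close>
  have 0: "p 0 = p' 0"
    using fun_cong[OF nbr[of 0], of 1] fun_cong[OF nbr[of 1], of 1] n
    by (simp add: Lambda_nbr_def)
  have tail: "p (Suc i) = p' (Suc i)" if "i < n" for i
    using fun_cong[OF nbr[of 0], of i] fun_cong[OF nbr[of 0], of "Suc i"] that 0
    by (simp add: Lambda_nbr_def)
  have "p i = p' i" for i
  proof (cases i)
    case (Suc j)
    then show ?thesis
      using tail[of j] p by (cases "j < n") (simp_all add: coord_space_def)
  qed (simp add: 0)
  then show ?thesis by blast
qed

text \<open>A line of \<open>\<Gamma>\<close> is normalised by its point \<open>y\<close> with entry 0 at index 0.\<close>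

lemma Lambda_nbr_0_surj:
  assumes "y \<in> coord_space (n + 1)" "y 0 = 0"
  obtains p where "p \<in> coord_space (n + 1)" "p 0 = t" "Lambda_nbr n p 0 = y"
proof -
  \<comment> \<open>The recurrence with \<open>l = y\<close> is solved for the entries of
    \<open>p\<close>; the zeros beyond index \<open>n\<close> keep \<open>p\<close> in the
    coordinate space.\<close>
  define p where "p = (\<lambda>i. case i of 0 \<Rightarrow> t | Suc j \<Rightarrow> if j < n then t * y j - y (Suc j) else 0)"
  have "p \<in> coord_space (n + 1)" "p 0 = t"
    by (auto simp: p_def coord_space_def split: nat.split)
  moreover have "Lambda_adj n p y"
    by (auto simp: Lambda_adj_def p_def)
  then have "Lambda_nbr n p 0 = y"
    unfolding Lambda_adj_iff[OF assms(1)] assms(2) by simp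
  ultimately show thesis
    by (rule that)
qed

section \<open>Affine points and lines in the coordinates of a chart\<close>

locale affine_chart = g: Vector_Spaces.linear fscale fscale g
  for g :: "'a::field fvec \<Rightarrow> 'a fvec" +
  fixes n :: nat and H :: "'a fvec set" and v :: "'a fvec"
  assumes n: "n \<ge> 1"
    and subspace_H: "fv.subspace H"
    and bij: "bij_betw g (coord_space (n + 1)) H"
    and v: "v \<notin> H"
    and H_subset: "H \<subseteq> coord_space (n + 2)"
    and v_in: "v \<in> coord_space (n + 2)"
    and decomp: "x \<in> coord_space (n + 2) \<Longrightarrow> \<exists>c. \<exists>h\<in>H. x = fscale c v + h"
begin

abbreviation "V \<equiv> coord_space (n + 1) :: 'a fvec set"
abbreviation "W \<equiv> coord_space (n + 2) :: 'a fvec set"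
abbreviation "m t \<equiv> g (moment_vector n t)"

text \<open>The vector \<open>v\<close> serves as affine origin: an affine vector can be scaled to
  have \<open>v\<close>-coefficient 1, and \<open>g\<close> gives coordinates for the remaining
  summand in \<open>H\<close>.\<close>

definition "apoint l = fv.span {v + g l}"
text \<open>The line is spanned by the affine point of the neighbour of \<open>p\<close> with entry
  0 at index 0 and by the point at infinity with parameter \<open>p 0\<close>.\<close>

definition "aline p = fv.span {v + g (Lambda_nbr n p 0), m (p 0)}"

lemma g_in: "u \<in> V \<Longrightarrow> g u \<in> H"
  using bij by (auto simp: bij_betw_def)

lemma g_eq_iff: "u \<in> V \<Longrightarrow> u' \<in> V \<Longrightarrow> g u = g u' \<longleftrightarrow> u = u'"
  using bij by (auto simp: bij_betw_def inj_on_def)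

lemma m_in: "m t \<in> H"
  by (simp add: g_in moment_vector_in_coord_space del: Suc_eq_plus1 One_nat_def)

lemma m_nonzero: "m t \<noteq> 0"
proof
  assume "m t = 0"
  then have "moment_vector n t = 0"
    using g_eq_iff[OF moment_vector_in_coord_space fv.subspace_0[OF subspace_coord_space]]
    by (simp add: g.zero)
  from fun_cong[OF this, of 0] show False
    by (simp add: moment_vector_def)
qed

lemma scale_v_add_in_H_iff: "h \<in> H \<Longrightarrow> fscale c v + h \<in> H \<longleftrightarrow> c = 0"
proof
  assume "h \<in> H" "fscale c v + h \<in> H"
  then have "fscale c v \<in> H"
    using fv.subspace_diff[OF subspace_H] by fastforce
  then have "fscale (1 / c) (fscale c v) \<in> H"
    by (rule fv.subspace_scale[OF subspace_H])
  then show "c = 0"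
    using v by (cases "c = 0") (simp_all add: fv.scale_scale)
qed simp

lemma v_add_notin_H: "h \<in> H \<Longrightarrow> v + h \<notin> H"
  using scale_v_add_in_H_iff[of h 1] by simp

text \<open>Makes the normalised representative of an affine point unique: \<open>v\<close> lies
  outside \<open>H\<close>, so the \<open>v\<close>-coefficients 1 and \<open>c\<close> must
  agree.\<close>

lemma v_add_eq_scaleD:
  assumes "h \<in> H" "h' \<in> H" "v + h = fscale c (v + h')"
  shows "c = 1 \<and> h = h'"
proof -
  have "fscale (1 - c) v + h = fscale c h'"
    using assms(3) by (simp add: algebra_simps)
  then have "c = 1"
    using scale_v_add_in_H_iff[OF assms(1), of "1 - c"] assms(2)
      fv.subspace_scale[OF subspace_H, of h' c] by simp
  then show ?thesis
    using assms(3) by simp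
qed

lemma affine_vector:
  assumes "x \<in> W" "x \<notin> H"
  obtains c u where "c \<noteq> 0" "u \<in> V" "fscale c x = v + g u"
proof -
  obtain c h where h: "h \<in> H" "x = fscale c v + h"
    using decomp assms by blast
  then have c: "c \<noteq> 0"
    using assms by auto
  obtain u where u: "u \<in> V" "fscale (1 / c) h = g u"
    using fv.subspace_scale[OF subspace_H h(1), of "1 / c"] bij by (auto simp: bij_betw_def)
  have "fscale (1 / c) x = v + g u"
    using c h u by (simp add: fv.scale_right_distrib fv.scale_scale)
  with c u that[of "1 / c" u] show ?thesis by simp
qed

lemma v_add_in_W: "u \<in> V \<Longrightarrow> v + g u \<in> W"
  using g_in H_subset v_in fv.subspace_add[OF subspace_coord_space] by blast

lemma bij_betw_apoint: "bij_betw apoint V (affine_points n H)"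
proof (rule bij_betw_imageI)
  show "inj_on apoint V"
  proof (rule inj_onI)
    fix l l' assume l: "l \<in> V" "l' \<in> V" "apoint l = apoint l'"
    then have "v + g l \<in> fv.span {v + g l'}"
      using fv.span_base[of "v + g l"] by (auto simp: apoint_def)
    then have "g l = g l'"
      using v_add_eq_scaleD g_in l by (auto simp: mem_span_singleton)
    then show "l = l'"
      using l g_eq_iff by blast
  qed
  show "apoint ` V = affine_points n H"
  proof (intro equalityI subsetI)
    fix P assume "P \<in> apoint ` V"
    then obtain l where l: "l \<in> V" "P = fv.span {v + g l}"
      by (auto simp: apoint_def)
    then show "P \<in> affine_points n H"
      unfolding mem_affine_points_iff[OF subspace_H] using v_add_in_W v_add_notin_H g_in by blast
  next
    fix P assume "P \<in> affine_points n H"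
    then obtain x where x: "x \<in> W" "x \<notin> H" "P = fv.span {x}"
      unfolding mem_affine_points_iff[OF subspace_H] by blast
    then obtain c u where "c \<noteq> 0" "u \<in> V" "fscale c x = v + g u"
      using affine_vector by blast
    then show "P \<in> apoint ` V"
      using x span_scale_singleton[of c x] by (auto simp: apoint_def)
  qed
qed

text \<open>Comparing \<open>v\<close>-coefficients forces \<open>c = 1\<close>, which leaves an
  equation inside \<open>H\<close>. Pulled back along the injective linear map \<open>g\<close>, it
  says that \<open>l\<close> lies on the affine line of neighbours of \<open>p\<close>.\<close>

lemma apoint_subset_aline_iff:
  assumes "l \<in> V"
  shows "apoint l \<subseteq> aline p \<longleftrightarrow> Lambda_adj n p l"
proof -
  let ?y = "Lambda_nbr n p 0"
  have "apoint l \<subseteq> aline p \<longleftrightarrow> (\<exists>c d. v + g l = fscale c (v + g ?y) + fscale d (m (p 0)))"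
    by (simp add: apoint_def aline_def span_singleton_subset_iff mem_span_pair)
  also have "\<dots> \<longleftrightarrow> (\<exists>d. g l = g ?y + fscale d (m (p 0)))"
  proof
    assume "\<exists>c d. v + g l = fscale c (v + g ?y) + fscale d (m (p 0))"
    then obtain c d where "v + (g l - fscale d (m (p 0))) = fscale c (v + g ?y)"
      by (auto simp: algebra_simps)
    moreover have "g l - fscale d (m (p 0)) \<in> H"
      by (intro fv.subspace_diff[OF subspace_H] fv.subspace_scale[OF subspace_H] g_in assms m_in)
    ultimately have "g l - fscale d (m (p 0)) = g ?y"
      using v_add_eq_scaleD[of _ "g ?y"] g_in[OF Lambda_nbr_in_coord_space] by blast
    then show "\<exists>d. g l = g ?y + fscale d (m (p 0))"
      by (metis diff_add_cancel)
  next
    assume "\<exists>d. g l = g ?y + fscale d (m (p 0))"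
    then obtain d where "v + g l = fscale 1 (v + g ?y) + fscale d (m (p 0))"
      by (auto simp: algebra_simps)
    then show "\<exists>c d. v + g l = fscale c (v + g ?y) + fscale d (m (p 0))"
      by blast
  qed
  also have "\<dots> \<longleftrightarrow> (\<exists>d. g l = g (Lambda_nbr n p d))"
    by (subst Lambda_nbr_eq_add) (simp add: g.add g.scale)
  also have "\<dots> \<longleftrightarrow> (\<exists>d. l = Lambda_nbr n p d)"
    using assms g_eq_iff Lambda_nbr_in_coord_space by blast
  also have "\<dots> \<longleftrightarrow> Lambda_adj n p l"
    unfolding Lambda_adj_iff[OF assms] by (auto simp: Lambda_nbr_def)
  finally show ?thesis .
qed

lemma bij_betw_aline:
  assumes K: "K = range (\<lambda>t. fv.span {m t})"
  shows "bij_betw aline V (affine_lines_through n H K)"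
proof (rule bij_betw_imageI)
  \<comment> \<open>Equal lines contain the same affine points, so the two arguments have the same
    neighbours.\<close>
  show "inj_on aline V"
    by (rule inj_onI) (metis Lambda_points_eqI[OF n] apoint_subset_aline_iff)
  show "aline ` V = affine_lines_through n H K"
  proof (intro equalityI subsetI)
    fix L assume "L \<in> aline ` V"
    then obtain p where p: "p \<in> V" "L = fv.span {v + g (Lambda_nbr n p 0), m (p 0)}"
      (is "_ = fv.span {?x, _}")
      by (auto simp: aline_def)
    have x: "?x \<notin> H"
      by (intro v_add_notin_H g_in Lambda_nbr_in_coord_space)
    note ind = independent_pair[OF subspace_H x m_in m_nonzero[of "p 0"]]
    have "fv.dim L = 2"
      using ind p fv.dim_span_eq_card_independent by metis
    moreover have "L \<subseteq> W"
      unfolding p(2) using subsetD[OF H_subset m_in] v_add_in_W[OF Lambda_nbr_in_coord_space]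
      by (intro fv.span_minimal subspace_coord_space) blast
    moreover have "?x \<in> L" "fv.span {m (p 0)} \<subseteq> L"
      unfolding p(2) by (simp_all add: fv.span_base fv.span_mono)
    moreover have "fv.subspace L"
      unfolding p(2) by (rule fv.subspace_span)
    ultimately show "L \<in> affine_lines_through n H K"
      unfolding affine_lines_through_def pg_lines_def using x K by blast
  next
    fix L assume "L \<in> affine_lines_through n H K"
    then obtain t where L: "fv.subspace L" "L \<subseteq> W" "fv.dim L = 2" "\<not> L \<subseteq> H" "fv.span {m t} \<subseteq> L"
      using K by (auto simp: affine_lines_through_def pg_lines_def)
    then obtain x where x: "x \<in> L" "x \<in> W" "x \<notin> H"
      by blast
    then obtain c u where u: "c \<noteq> 0" "u \<in> V" "fscale c x = v + g u"
      using affine_vector by blast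
    \<comment> \<open>The affine point is moved along the direction of the line until its entry at
      index 0 vanishes; the moment vector has entry 1 there.\<close>
    define y where "y = u - fscale (u 0) (moment_vector n t)"
    have y: "y \<in> V" "y 0 = 0"
      unfolding y_def
      by (intro fv.subspace_diff fv.subspace_scale subspace_coord_space u(2)
          moment_vector_in_coord_space) (simp add: moment_vector_def)
    obtain p where p: "p \<in> V" "p 0 = t" "Lambda_nbr n p 0 = y"
      using Lambda_nbr_0_surj[OF y] by blast
    have mL: "m t \<in> L"
      using L span_singleton_subset_iff by blast
    have "v + g y = fscale c x - fscale (u 0) (m t)"
      by (simp add: u y_def g.diff g.scale)
    then have "v + g y \<in> L"
      using fv.subspace_diff fv.subspace_scale L x mL by metis
    moreover note ind = independent_pair[OF subspace_H v_add_notin_H[OF g_in[OF y(1)]] m_in m_nonzero[of t]]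
    ultimately have "fv.span {v + g y, m t} = L"
      using L mL by (intro span_eq_if_dim_eq_card) auto
    then show "L \<in> aline ` V"
      using p by (auto simp: aline_def)
  qed
qed

lemma graph_isomorphic_Lambda_Gamma:
  assumes "K = range (\<lambda>t. fv.span {m t})"
  shows "graph_isomorphic (Lambda_graph n :: ('a fvec + 'a fvec) graph) (Gamma_graph n H K)"
  unfolding Lambda_graph_def Gamma_graph_def
  by (rule graph_isomorphic_bipartite_swap[OF bij_betw_aline[OF assms] bij_betw_apoint])
    (simp add: apoint_subset_aline_iff Lambda_adj_def)

end

section \<open>Reduction of the general configuration to a chart\<close>

theorem theorem5p1:
  fixes n q :: nat
    and H :: "'a::{field,finite} fvec set"
    and K N :: "'a fvec set set"
  assumes "CARD('a) = q"
    and "n \<ge> 2"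
    and "H \<in> pg_hyperplanes (coord_space (n + 2))"
    and "pg_arc n H q K"
    and "normal_rational_curve n H N"
    and "K \<subseteq> N"
  shows "graph_isomorphic (Lambda_graph n :: ('a fvec + 'a fvec) graph) (Gamma_graph n H K)"
proof -
  obtain f where f: "Vector_Spaces.linear fscale fscale f" "bij_betw f (coord_space (n + 1)) H"
    and N: "N = (\<lambda>P. f ` P) ` standard_nrc n"
    using assms(5) by (auto simp: normal_rational_curve_def projectively_equivalent_def)
  interpret f: Vector_Spaces.linear fscale fscale f by (rule f)
  \<comment> \<open>\<open>S\<close> selects one preimage for each point of \<open>K\<close>, so it
    inherits the cardinality q from \<open>K\<close>.\<close>
  obtain S where S: "S \<subseteq> standard_nrc n" "K = (\<lambda>P. f ` P) ` S" "inj_on (\<lambda>P. f ` P) S"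
    using assms(6) unfolding N by (metis subset_image_inj)
  have "card S = CARD('a)"
    using assms(1,4) S by (simp add: pg_arc_def card_image)
  then obtain g where g: "Vector_Spaces.linear fscale fscale g"
    "bij_betw g (coord_space (n + 1)) (coord_space (n + 1) :: 'a fvec set)"
    "S = range (\<lambda>t. fv.span {g (moment_vector n t)})"
    using standard_nrc_delete_point[OF _ S(1)] assms(2) by (metis One_nat_def Suc_1 Suc_leD)
  obtain v where "v \<in> coord_space (n + 2)" "v \<notin> H"
    "\<And>x. x \<in> coord_space (n + 2) \<Longrightarrow> \<exists>c. \<exists>h\<in>H. x = fscale c v + h"
    using hyperplane_complement[OF assms(3) subspace_coord_space] by blast
  moreover have "fv.subspace H" "H \<subseteq> coord_space (n + 2)"
    using assms(3) by (auto simp: pg_hyperplanes_def)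
  \<comment> \<open>In the chart \<open>f \<circ> g\<close>, the map \<open>g\<close> makes the
    point at infinity of the standard curve the omitted one, and \<open>f\<close> carries the
    standard curve to \<open>N\<close>.\<close>
  ultimately interpret affine_chart "f \<circ> g" n H v
    using Vector_Spaces.linear_compose[OF g(1) f(1)] bij_betw_trans[OF g(2) f(2)] assms(2)
    by (simp add: affine_chart_def affine_chart_axioms_def)
  have "K = range (\<lambda>t. fv.span {(f \<circ> g) (moment_vector n t)})"
    unfolding S(2) g(3) image_image by (simp flip: f.span_image)
  then show ?thesis
    by (rule graph_isomorphic_Lambda_Gamma)
qed

end
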